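(* Let $n, d \ge 1$ be integers and let $V_1, \dots, V_n \subseteq B_2^d$ be sets of vectors (vector families) with $0 \in \sum_{i=1}^n \mathrm{conv}\, V_i$. Then there exists a selection of vectors $v_i \in V_i$ for $i = 1, \dots, n$ such that $$\Big\| \sum_{i=1}^n v_i \Big\|_2 \le \sqrt{d}.$$
   Context: $B_2^d = \{x \in \mathbb{R}^d : \|x\|_2 \le 1\}$ is the closed Euclidean unit ball of $\mathbb{R}^d$, $\mathrm{conv}$ denotes the convex hull, and $\sum_{i=1}^n \mathrm{conv}\, V_i$ is the Minkowski sum $\{x_1 + \dots + x_n : x_i \in \mathrm{conv}\, V_i\}$. *)

theory Defs
  imports "HOL-Analysis.Analysis" "HOL-Library.Set_Algebras"
begin

end

theory Submission
  imports Defs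
begin

text \<open>
  Write \<open>0 = z\<^sub>1 + \<dots> + z\<^sub>n\<close> with \<open>z\<^sub>i\<close> in the convex hull of \<open>V\<^sub>i\<close>. Two ideas combine.

  The first is the Shapley--Folkman theorem: the \<open>z\<^sub>i\<close> can be changed, keeping their sum and staying
  in the hulls, so that all but at most \<open>d\<close> of them are already points of their \<open>V\<^sub>i\<close>. Whenever
  more than \<open>d\<close> of them are not, each of these lies on a segment from a point \<open>a\<^sub>i\<close> of a finite
  generating set to the hull of the remaining generators. The directions of more than \<open>d\<close> segments
  are linearly dependent, so the points slide along their segments at speeds that cancel in
  the sum, until one of them reaches an end of its segment and needs fewer generators
  (\<open>shapley_folkman_finite\<close>).

  The second is derandomised rounding. Choosing independent random \<open>v\<^sub>i\<close> in \<open>V\<^sub>i\<close> with mean \<open>z\<^sub>i\<close>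
  makes the expected squared norm of \<open>\<Sum> (v\<^sub>i - z\<^sub>i)\<close> the sum of the variances, each of which is at
  most \<open>1\<close>, and \<open>0\<close> if \<open>z\<^sub>i\<close> was in \<open>V\<^sub>i\<close> and is kept. Instead of taking expectations, the \<open>v\<^sub>i\<close> are
  chosen one after another so that the squared error grows by at most \<open>1\<close> at each rounded
  index (\<open>rounding_step\<close>). At most \<open>d\<close> indices are rounded, which gives the bound \<open>\<surd>d\<close>.
\<close>

lemma indexed_family_dependent:
  fixes w :: "'i \<Rightarrow> 'a::euclidean_space"
  assumes "finite K" and "DIM('a) < card K"
  obtains c k where "(\<Sum>i\<in>K. c i *\<^sub>R w i) = 0" and "k \<in> K" and "c k \<noteq> (0::real)"
proof (cases "inj_on w K")
  case True
  then have "DIM('a) < card (w ` K)"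
    using assms by (simp add: card_image)
  then have "dependent (w ` K)"
    using dependent_biggerset assms(1) by blast
  then obtain u x where u: "(\<Sum>v\<in>w ` K. u v *\<^sub>R v) = 0" and x: "x \<in> w ` K" "u x \<noteq> 0"
    using dependent_finite[of "w ` K"] assms(1) by auto
  from x obtain k where k: "k \<in> K" "u (w k) \<noteq> 0"
    by auto
  have "(\<Sum>i\<in>K. u (w i) *\<^sub>R w i) = 0"
    using u True by (simp add: sum.reindex)
  from that[of "\<lambda>i. u (w i)", OF this k] show ?thesis .
next
  case False
  then obtain a b where ab: "a \<in> K" "b \<in> K" "a \<noteq> b" "w a = w b"
    by (auto simp: inj_on_def)
  define c where "c i = (if i = a then 1 else if i = b then -1 else (0::real))" for i
  have "(\<Sum>i\<in>K. c i *\<^sub>R w i) = (\<Sum>i\<in>{a, b}. c i *\<^sub>R w i)"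
    by (rule sum.mono_neutral_right) (use assms(1) ab in \<open>auto simp: c_def\<close>)
  also have "\<dots> = 0"
    using ab by (simp add: c_def)
  finally show ?thesis
    using that[of c a] ab(1) by (simp add: c_def)
qed

text \<open>
  Each moving coordinate has a last time \<open>T i\<close> at which it is still between \<open>0\<close> and \<open>1\<close>, and it
  is then at one of these two values. At the least of these times no coordinate has left yet.
\<close>

lemma line_meets_unit_cube_boundary:
  fixes s c :: "'i \<Rightarrow> real"
  assumes "finite K" and s: "\<And>i. i \<in> K \<Longrightarrow> 0 \<le> s i \<and> s i \<le> 1"
    and k: "k \<in> K" "c k \<noteq> 0"
  obtains t j where "\<And>i. i \<in> K \<Longrightarrow> 0 \<le> s i + t * c i \<and> s i + t * c i \<le> 1"
    and "j \<in> K" and "s j + t * c j = 0 \<or> s j + t * c j = 1"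
proof -
  define T where "T i = (if c i > 0 then (1 - s i) / c i else - s i / c i)" for i
  define M where "M = {i\<in>K. c i \<noteq> 0}"
  define t where "t = Min (T ` M)"
  have M: "finite (T ` M)" "T ` M \<noteq> {}"
    using assms(1) k by (auto simp: M_def)
  obtain j where j: "j \<in> M" "t = T j"
    using Min_in[OF M] by (auto simp: t_def)
  have "0 \<le> T i" if "i \<in> M" for i
    using that s[of i] by (auto simp: M_def T_def divide_simps)
  then have t0: "0 \<le> t"
    using j by simp
  have "0 \<le> s i + t * c i \<and> s i + t * c i \<le> 1" if i: "i \<in> K" for i
  proof (cases "c i = 0")
    case True
    then show ?thesis using s[OF i] by simp
  next
    case False
    then have le: "t \<le> T i"
      using i M by (auto simp: t_def M_def)
    show ?thesis
    proof (cases "c i > 0")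
      case True
      then have "t * c i \<le> 1 - s i" "0 \<le> t * c i"
        using le t0 by (auto simp: T_def pos_le_divide_eq)
      then show ?thesis using s[OF i] by linarith
    next
      case neg: False
      then have "c i < 0" using False by simp
      then have "- s i \<le> t * c i" "t * c i \<le> 0"
        using le t0 neg_le_divide_eq[of "c i" t "- s i"]
        by (auto simp: T_def mult_nonneg_nonpos)
      then show ?thesis using s[OF i] by linarith
    qed
  qed
  moreover have "s j + t * c j = 0 \<or> s j + t * c j = 1"
    using j by (auto simp: T_def M_def)
  moreover have "j \<in> K"
    using j by (simp add: M_def)
  ultimately show ?thesis
    using that by blast
qed

lemma convex_hull_finite_split_vertex:
  fixes F :: "'a::real_vector set"
  assumes "finite F" and "z \<in> convex hull F" and "z \<notin> F"
  obtains a p s where "a \<in> F" and "p \<in> convex hull (F - {a})" and "0 \<le> s" and "s \<le> 1"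
    and "z = a + s *\<^sub>R (p - a)"
proof -
  obtain a where a: "a \<in> F"
    using assms(2) by fastforce
  then have ins: "insert a (F - {a}) = F"
    by auto
  have ne: "F - {a} \<noteq> {}"
  proof
    assume "F - {a} = {}"
    then have "F = {a}" using a by auto
    then show False using assms by simp
  qed
  obtain u s p where "u \<ge> 0" "s \<ge> 0" "u + s = 1" and p: "p \<in> convex hull (F - {a})"
      and z: "z = u *\<^sub>R a + s *\<^sub>R p"
    using assms(2) convex_hull_insert[OF ne, of a] unfolding ins by auto
  then have u: "u = 1 - s" and "s \<le> 1"
    by auto
  have "z = a + s *\<^sub>R (p - a)"
    unfolding z u by (simp add: algebra_simps)
  with that a p \<open>s \<ge> 0\<close> \<open>s \<le> 1\<close> show ?thesis
    by blast
qed

text \<open>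
  The measure of progress is the total number of generators. A point that slides along its segment
  loses a generator at either end: at \<open>a i\<close> it needs only \<open>a i\<close>, and at \<open>p i\<close> it no longer
  needs \<open>a i\<close>.
\<close>

lemma shapley_folkman_finite:
  fixes F :: "'i \<Rightarrow> 'a::euclidean_space set"
  assumes "finite I" and "\<And>i. i \<in> I \<Longrightarrow> finite (F i)"
    and "\<And>i. i \<in> I \<Longrightarrow> z i \<in> convex hull F i"
  shows "\<exists>y. (\<forall>i\<in>I. y i \<in> convex hull F i) \<and> sum y I = sum z I
           \<and> card {i\<in>I. y i \<notin> F i} \<le> DIM('a)"
  using assms(2,3)
proof (induction "\<Sum>i\<in>I. card (F i)" arbitrary: F z rule: less_induct)
  case less
  have reduce: ?case
    if j: "j \<in> I" and G: "G \<subset> F j" and z'j: "z' j \<in> convex hull G"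
      and z': "\<And>i. i \<in> I \<Longrightarrow> z' i \<in> convex hull F i" and eq: "sum z' I = sum z I"
    for j G z'
  proof -
    define F' where "F' = F(j := G)"
    have sub: "F' i \<subseteq> F i" for i
      using G by (auto simp: F'_def)
    have "(\<Sum>i\<in>I. card (F' i)) < (\<Sum>i\<in>I. card (F i))"
    proof (rule sum_strict_mono_ex1[OF assms(1)])
      show "\<forall>i\<in>I. card (F' i) \<le> card (F i)"
        using sub less.prems(1) by (simp add: card_mono)
      show "\<exists>i\<in>I. card (F' i) < card (F i)"
        using j G less.prems(1) by (auto simp: F'_def psubset_card_mono)
    qed
    moreover have "finite (F' i)" if "i \<in> I" for i
      using sub less.prems(1)[OF that] finite_subset by blast
    moreover have "z' i \<in> convex hull F' i" if "i \<in> I" for i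
      using z'[OF that] z'j by (auto simp: F'_def)
    ultimately obtain y where y: "\<forall>i\<in>I. y i \<in> convex hull F' i" "sum y I = sum z' I"
        "card {i\<in>I. y i \<notin> F' i} \<le> DIM('a)"
      using less.hyps[of F' z'] by blast
    have "card {i\<in>I. y i \<notin> F i} \<le> card {i\<in>I. y i \<notin> F' i}"
      by (rule card_mono) (use assms(1) sub in auto)
    moreover have "\<forall>i\<in>I. y i \<in> convex hull F i"
      using y(1) sub hull_mono by blast
    ultimately show ?thesis
      using y eq by (intro exI[of _ y]) auto
  qed
  define K where "K = {i\<in>I. z i \<notin> F i}"
  have K: "finite K" "K \<subseteq> I"
    using assms(1) by (auto simp: K_def)
  show ?case
  proof (cases "card K \<le> DIM('a)")
    case True
    then show ?thesis
      using less.prems(2) by (intro exI[of _ z]) (auto simp: K_def)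
  next
    case False
    have "\<exists>a p s. a \<in> F i \<and> p \<in> convex hull (F i - {a}) \<and> 0 \<le> s \<and> s \<le> (1::real)
            \<and> z i = a + s *\<^sub>R (p - a)" if "i \<in> K" for i
      using that less.prems convex_hull_finite_split_vertex[of "F i" "z i"]
      by (auto simp: K_def) metis
    then obtain a p s where a: "\<And>i. i \<in> K \<Longrightarrow> a i \<in> F i"
      and p: "\<And>i. i \<in> K \<Longrightarrow> p i \<in> convex hull (F i - {a i})"
      and s: "\<And>i. i \<in> K \<Longrightarrow> 0 \<le> s i \<and> s i \<le> (1::real)"
      and z: "\<And>i. i \<in> K \<Longrightarrow> z i = a i + s i *\<^sub>R (p i - a i)"
      by metis
    obtain c k where c: "(\<Sum>i\<in>K. c i *\<^sub>R (p i - a i)) = 0" and k: "k \<in> K" "c k \<noteq> 0"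
      using indexed_family_dependent[of K "\<lambda>i. p i - a i"] K False by auto
    obtain t j where t: "\<And>i. i \<in> K \<Longrightarrow> 0 \<le> s i + t * c i \<and> s i + t * c i \<le> 1"
      and j: "j \<in> K" and end_j: "s j + t * c j = 0 \<or> s j + t * c j = 1"
      using line_meets_unit_cube_boundary[of K s k c] K s k by metis
    define z' where "z' i = (if i \<in> K then z i + (t * c i) *\<^sub>R (p i - a i) else z i)" for i
    have z'_alt: "z' i = a i + (s i + t * c i) *\<^sub>R (p i - a i)" if "i \<in> K" for i
      using z[OF that] that by (simp add: z'_def algebra_simps)
    have z'_hull: "z' i \<in> convex hull F i" if i: "i \<in> I" for i
    proof (cases "i \<in> K")
      case True
      let ?r = "s i + t * c i"
      have "a i \<in> convex hull F i" "p i \<in> convex hull F i"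
        using a[OF True] p[OF True] hull_mono[of "F i - {a i}" "F i"] by (auto simp: hull_inc)
      then have "(1 - ?r) *\<^sub>R a i + ?r *\<^sub>R p i \<in> convex hull F i"
        using t[OF True] by (intro convexD[OF convex_convex_hull]) auto
      then show ?thesis
        unfolding z'_alt[OF True] by (simp add: algebra_simps)
    next
      case False
      then show ?thesis using less.prems(2)[OF i] by (simp add: z'_def)
    qed
    have "sum z' I = (\<Sum>i\<in>I. z i + (if i \<in> K then (t * c i) *\<^sub>R (p i - a i) else 0))"
      by (rule sum.cong) (auto simp: z'_def)
    also have "\<dots> = sum z I + (\<Sum>i\<in>K. (t * c i) *\<^sub>R (p i - a i))"
      using K assms(1) by (simp add: sum.distrib sum.If_cases Int_absorb1)
    also have "(\<Sum>i\<in>K. (t * c i) *\<^sub>R (p i - a i)) = t *\<^sub>R (\<Sum>i\<in>K. c i *\<^sub>R (p i - a i))"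
      by (simp add: scaleR_sum_right)
    finally have z'_sum: "sum z' I = sum z I"
      using c by simp
    have jI: "j \<in> I" using j K by auto
    from end_j show ?thesis
    proof
      assume "s j + t * c j = 0"
      then have "z' j \<in> convex hull {a j}"
        by (simp add: z'_alt[OF j])
      moreover have "{a j} \<subset> F j"
        using a[OF j] p[OF j] by (cases "F j = {a j}") auto
      ultimately show ?thesis
        using reduce[OF jI _ _ z'_hull z'_sum] by blast
    next
      assume "s j + t * c j = 1"
      then have "z' j \<in> convex hull (F j - {a j})"
        using p[OF j] by (simp add: z'_alt[OF j])
      moreover have "F j - {a j} \<subset> F j"
        using a[OF j] by auto
      ultimately show ?thesis
        using reduce[OF jI _ _ z'_hull z'_sum] by blast
    qed
  qed
qed

text \<open>
  By Caratheodory's theorem each summand lies in the hull of finitely many points of its set.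
\<close>

theorem shapley_folkman:
  fixes V :: "'i \<Rightarrow> 'a::euclidean_space set"
  assumes "finite I" and "\<And>i. i \<in> I \<Longrightarrow> z i \<in> convex hull V i"
  obtains y where "\<And>i. i \<in> I \<Longrightarrow> y i \<in> convex hull V i" and "sum y I = sum z I"
    and "card {i\<in>I. y i \<notin> V i} \<le> DIM('a)"
proof -
  have "\<exists>F. finite F \<and> F \<subseteq> V i \<and> z i \<in> convex hull F" if "i \<in> I" for i
    using assms(2)[OF that] unfolding caratheodory[of "V i"] by blast
  then obtain F where F: "\<And>i. i \<in> I \<Longrightarrow> finite (F i)" "\<And>i. i \<in> I \<Longrightarrow> F i \<subseteq> V i"
    "\<And>i. i \<in> I \<Longrightarrow> z i \<in> convex hull F i"
    by metis
  obtain y where y: "\<forall>i\<in>I. y i \<in> convex hull F i" "sum y I = sum z I"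
      "card {i\<in>I. y i \<notin> F i} \<le> DIM('a)"
    using shapley_folkman_finite[of I F z] assms(1) F(1,3) by blast
  have "card {i\<in>I. y i \<notin> V i} \<le> card {i\<in>I. y i \<notin> F i}"
    by (rule card_mono) (use assms(1) F(2) in auto)
  moreover have "y i \<in> convex hull V i" if "i \<in> I" for i
    using y(1) F(2)[OF that] that hull_mono by blast
  ultimately show ?thesis
    using that[of y] y(2,3) by (meson le_trans)
qed

text \<open>
  Convexity replaces the expectation. For \<open>v\<close> in the unit ball the squared norm of
  \<open>e + (v - y)\<close> is at most an affine function of \<open>v\<close>, since \<open>v \<bullet> v \<le> 1\<close>. At \<open>v = y\<close> that
  function is \<open>e \<bullet> e + 1 - y \<bullet> y\<close>. An affine function that exceeded \<open>e \<bullet> e + 1\<close> on all of \<open>V\<close>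
  would exceed it on the convex hull, hence at \<open>y\<close>.
\<close>

lemma rounding_step:
  fixes V :: "'a::real_inner set"
  assumes V: "V \<subseteq> cball 0 1" and y: "y \<in> convex hull V"
  obtains v where "v \<in> V" and "(norm (e + (v - y)))\<^sup>2 \<le> (norm e)\<^sup>2 + 1"
proof -
  have "\<exists>v\<in>V. (e - y) \<bullet> v \<le> e \<bullet> y - (y \<bullet> y) / 2"
  proof (rule ccontr)
    assume "\<not> ?thesis"
    then have "V \<subseteq> {v. (e - y) \<bullet> v > e \<bullet> y - (y \<bullet> y) / 2}"
      by auto
    then have "convex hull V \<subseteq> {v. (e - y) \<bullet> v > e \<bullet> y - (y \<bullet> y) / 2}"
      by (rule hull_minimal) (rule convex_halfspace_gt)
    then have "(e - y) \<bullet> y > e \<bullet> y - (y \<bullet> y) / 2"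
      using y by blast
    then show False
      using inner_ge_zero[of y] by (simp add: inner_diff_left)
  qed
  then obtain v where v: "v \<in> V" "(e - y) \<bullet> v \<le> e \<bullet> y - (y \<bullet> y) / 2"
    by blast
  have "v \<bullet> v \<le> 1"
    using v(1) V by (auto simp flip: power2_norm_eq_inner simp: power_le_one)
  moreover have "(norm (e + (v - y)))\<^sup>2
      = e \<bullet> e + v \<bullet> v + y \<bullet> y + 2 * ((e - y) \<bullet> v) - 2 * (e \<bullet> y)"
    by (simp add: power2_norm_eq_inner algebra_simps inner_commute)
  ultimately have "(norm (e + (v - y)))\<^sup>2 \<le> (norm e)\<^sup>2 + 1"
    using v(2) by (simp add: power2_norm_eq_inner)
  with that v(1) show ?thesis
    by blast
qed

text \<open>
  Only indices with \<open>y i\<close> outside \<open>V i\<close> are charged: at the others \<open>y i\<close> itself is chosen, which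
  leaves the accumulated error unchanged.
\<close>

lemma rounding_error:
  fixes V :: "'i \<Rightarrow> 'a::real_inner set"
  assumes "finite I" and "\<And>i. i \<in> I \<Longrightarrow> V i \<subseteq> cball 0 1"
    and "\<And>i. i \<in> I \<Longrightarrow> y i \<in> convex hull V i"
  shows "\<exists>v. (\<forall>i\<in>I. v i \<in> V i)
           \<and> (norm (\<Sum>i\<in>I. v i - y i))\<^sup>2 \<le> real (card {i\<in>I. y i \<notin> V i})"
  using assms
proof (induction I)
  case empty
  then show ?case by simp
next
  case (insert j I)
  then obtain v where v: "\<forall>i\<in>I. v i \<in> V i"
      "(norm (\<Sum>i\<in>I. v i - y i))\<^sup>2 \<le> real (card {i\<in>I. y i \<notin> V i})"
    by auto
  define e where "e = (\<Sum>i\<in>I. v i - y i)"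
  have upd: "(\<Sum>i\<in>insert j I. (v(j := x)) i - y i) = e + (x - y j)" for x
  proof -
    have "(\<Sum>i\<in>I. (v(j := x)) i - y i) = e"
      unfolding e_def by (rule sum.cong) (use insert.hyps in auto)
    then show ?thesis
      using insert.hyps by (simp add: add.commute)
  qed
  obtain x where x: "x \<in> V j"
    "(norm (e + (x - y j)))\<^sup>2 \<le> real (card {i\<in>insert j I. y i \<notin> V i})"
  proof (cases "y j \<in> V j")
    case True
    then have "{i\<in>insert j I. y i \<notin> V i} = {i\<in>I. y i \<notin> V i}"
      by auto
    then show ?thesis
      using that[of "y j"] True v(2) by (simp add: e_def)
  next
    case False
    then have "{i\<in>insert j I. y i \<notin> V i} = insert j {i\<in>I. y i \<notin> V i}"
      by auto
    then have card: "card {i\<in>insert j I. y i \<notin> V i} = Suc (card {i\<in>I. y i \<notin> V i})"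
      using insert.hyps by simp
    obtain x where "x \<in> V j" "(norm (e + (x - y j)))\<^sup>2 \<le> (norm e)\<^sup>2 + 1"
      using rounding_step[of "V j" "y j" e] insert.prems by blast
    with that[of x] card v(2) show ?thesis
      by (simp add: e_def)
  qed
  have "\<forall>i\<in>insert j I. (v(j := x)) i \<in> V i"
    using v(1) x(1) by auto
  then show ?case
    using x(2) unfolding upd[symmetric] by blast
qed

theorem theorem1p4:
  fixes n :: nat and V :: "nat \<Rightarrow> (real ^ 'd) set"
  assumes "n \<ge> 1"
    and "\<And>i. i \<in> {1..n} \<Longrightarrow> V i \<subseteq> cball 0 1"
    and "0 \<in> (\<Sum>i\<in>{1..n}. convex hull (V i))"
  shows "\<exists>v :: nat \<Rightarrow> real ^ 'd.
           (\<forall>i\<in>{1..n}. v i \<in> V i) \<and>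
           norm (\<Sum>i\<in>{1..n}. v i) \<le> sqrt (real CARD('d))"
proof -
  obtain z where z: "\<And>i. i \<in> {1..n} \<Longrightarrow> z i \<in> convex hull V i" "sum z {1..n} = 0"
    using assms(3) unfolding set_sum_alt[OF finite_atLeastAtMost] by force
  obtain y where y: "\<And>i. i \<in> {1..n} \<Longrightarrow> y i \<in> convex hull V i" "sum y {1..n} = sum z {1..n}"
    "card {i\<in>{1..n}. y i \<notin> V i} \<le> DIM(real ^ 'd)"
    using shapley_folkman[of "{1..n}" z V] z(1) by blast
  obtain v where v: "\<forall>i\<in>{1..n}. v i \<in> V i"
    "(norm (\<Sum>i\<in>{1..n}. v i - y i))\<^sup>2 \<le> real (card {i\<in>{1..n}. y i \<notin> V i})"
    using rounding_error[of "{1..n}" V y] assms(2) y(1) by blast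
  have "(\<Sum>i\<in>{1..n}. v i - y i) = (\<Sum>i\<in>{1..n}. v i)"
    using y(2) z(2) by (simp add: sum_subtractf)
  then have "(norm (\<Sum>i\<in>{1..n}. v i))\<^sup>2 \<le> real CARD('d)"
    using v(2) y(3) by simp
  then have "norm (\<Sum>i\<in>{1..n}. v i) \<le> sqrt (real CARD('d))"
    by (rule real_le_rsqrt)
  with v(1) show ?thesis
    by blast
qed

end
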